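(* There exist a Bergman fan $\mathfrak{B}$ of dimension $2$ (pointed at $\mathbf{0}$) and a closed halfspace $H^+$ with $\mathbf 0\in\partial H^+$, in general position with respect to $\mathfrak{B}$, such that the integral $1$-group $(\mathbf{F}_1(\mathfrak{B}\cap H^+))_{|\mathbf{0}}$ is a strict subgroup of $(\mathbf{F}_1\mathfrak{B})_{|\mathbf{0}}$.
   Context: Bergman fans. Let $M$ be a loopless matroid on $[m]$, and let $e_1,\dots,e_m\in\mathbb{Z}^{m-1}\subset\mathbb{R}^{m-1}$ generate the lattice $\mathbb{Z}^{m-1}$ and satisfy $\sum e_i=0$; for $F\subset[m]$ put $e_F=\sum_{i\in F}e_i$. The Bergman fan $\mathfrak{B}(M)$ is the fan of all cones $\mathrm{pos}\{e_{F_1},\dots,e_{F_k}\}$ for chains $F_1\subsetneq\dots\subsetneq F_k$ of flats of $M$ with $\emptyset\ne F_1$, $F_k\ne[m]$. A halfspace with $\mathbf 0$ on its boundary is in general position with respect to a fan if no ray of the fan lies in its boundary. $\mathfrak{B}\cap H^+$ is the fan (collection of cones) $\{\sigma\cap H^+:\sigma\in\mathfrak{B}\}$. For a fan $\Sigma$ in $\mathbb{R}^d$ and $p\ge0$, the integral $p$-group $(\mathbf{F}_p\Sigma)_{|\mathbf 0}$ is the subgroup of $\bigwedge^p\mathbb{Z}^d$ generated by the elements $v_1\wedge\dots\wedge v_p$ where $v_1,\dots,v_p\in\mathbb{Z}^d$ are integer vectors lying in a common subspace $\mathrm{lin}\,\sigma$, $\sigma\in\Sigma$. *)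

theory Defs
  imports "Jordan_Normal_Form.VS_Connect" "Jordan_Normal_Form.DL_Submatrix"
    "HOL-Algebra.Generated_Groups"
begin

text \<open>Since the dimension is existentially quantified, \<open>\<real>\<^sup>d\<close> and \<open>\<int>\<^sup>d\<close> are rendered as the carriers
  \<open>carrier_vec d\<close> of the types \<open>real vec\<close> and \<open>int vec\<close>.\<close>

section \<open>Matroids and their flats\<close>

locale matroid =
  fixes E :: "'a set" and indep :: "'a set \<Rightarrow> bool"
  assumes finite_ground: "finite E"
    and indep_subset_ground: "indep X \<Longrightarrow> X \<subseteq> E"
    and indep_empty: "indep {}"
    and indep_subset: "indep X \<Longrightarrow> Y \<subseteq> X \<Longrightarrow> indep Y"
    and augment: "indep X \<Longrightarrow> indep Y \<Longrightarrow> card Y < card X \<Longrightarrow> \<exists>x\<in>X - Y. indep (insert x Y)"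

definition loopless :: "'a set \<Rightarrow> ('a set \<Rightarrow> bool) \<Rightarrow> bool" where
  "loopless E indep \<longleftrightarrow> (\<forall>x\<in>E. indep {x})"

definition matroid_rank :: "('a set \<Rightarrow> bool) \<Rightarrow> 'a set \<Rightarrow> nat" where
  "matroid_rank indep X = Max {card Y | Y. Y \<subseteq> X \<and> indep Y}"

definition flat :: "'a set \<Rightarrow> ('a set \<Rightarrow> bool) \<Rightarrow> 'a set \<Rightarrow> bool" where
  "flat E indep F \<longleftrightarrow>
     F \<subseteq> E \<and> (\<forall>x\<in>E - F. matroid_rank indep F < matroid_rank indep (insert x F))"


section \<open>Cones, linear spans and collections of cones\<close>

definition pos :: "nat \<Rightarrow> real vec set \<Rightarrow> real vec set" where
  "pos d S = {finsum_vec TYPE(real) d (\<lambda>v. c v \<cdot>\<^sub>v v) A | A c.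
                finite A \<and> A \<subseteq> S \<and> (\<forall>v\<in>A. 0 \<le> c v)}"

definition lin :: "nat \<Rightarrow> real vec set \<Rightarrow> real vec set" where
  "lin d S = LinearCombinations.module.span class_ring (module_vec TYPE(real) d) S"

definition cone_dim :: "nat \<Rightarrow> real vec set \<Rightarrow> nat" where
  "cone_dim d \<sigma> = vectorspace.dim class_ring ((module_vec TYPE(real) d)\<lparr>carrier := lin d \<sigma>\<rparr>)"

definition fan_dim :: "nat \<Rightarrow> real vec set set \<Rightarrow> nat" where
  "fan_dim d \<Sigma> = Max (cone_dim d ` \<Sigma>)"


section \<open>Bergman fans\<close>

definition lattice_frame :: "nat \<Rightarrow> (nat \<Rightarrow> int vec) \<Rightarrow> bool" where
  "lattice_frame m e \<longleftrightarrow>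
     (\<forall>i\<in>{1..m}. e i \<in> carrier_vec (m - 1)) \<and>
     generate (monoid_vec TYPE(int) (m - 1)) (e ` {1..m}) = carrier_vec (m - 1) \<and>
     finsum_vec TYPE(int) (m - 1) e {1..m} = 0\<^sub>v (m - 1)"

definition flat_vec :: "nat \<Rightarrow> (nat \<Rightarrow> int vec) \<Rightarrow> nat set \<Rightarrow> real vec" where
  "flat_vec d e F = map_vec of_int (finsum_vec TYPE(int) d e F)"

text \<open>The empty chain is admitted; it contributes the vertex \<open>{0}\<close> of the fan.\<close>

definition bergman_fan :: "nat \<Rightarrow> (nat \<Rightarrow> int vec) \<Rightarrow> (nat set \<Rightarrow> bool) \<Rightarrow> real vec set set" where
  "bergman_fan m e indep =
     {pos (m - 1) (flat_vec (m - 1) e ` C) | C.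
        subset.chain {F. flat {1..m} indep F \<and> F \<noteq> {} \<and> F \<noteq> {1..m}} C}"

definition is_bergman_fan :: "nat \<Rightarrow> real vec set set \<Rightarrow> bool" where
  "is_bergman_fan d B \<longleftrightarrow>
     (\<exists>m indep e. 1 \<le> m \<and> d = m - 1 \<and> matroid {1..m} indep \<and> loopless {1..m} indep \<and>
        lattice_frame m e \<and> B = bergman_fan m e indep)"


section \<open>Halfspaces\<close>

definition closed_halfspace :: "nat \<Rightarrow> real vec \<Rightarrow> real \<Rightarrow> real vec set" where
  "closed_halfspace d u c = {x \<in> carrier_vec d. c \<le> u \<bullet> x}"

definition boundary_hyperplane :: "nat \<Rightarrow> real vec \<Rightarrow> real \<Rightarrow> real vec set" where
  "boundary_hyperplane d u c = {x \<in> carrier_vec d. u \<bullet> x = c}"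

text \<open>General position of \<open>closed_halfspace d u c\<close>; the rays of a fan are its one-dimensional cones.\<close>

definition general_position :: "nat \<Rightarrow> real vec set set \<Rightarrow> real vec \<Rightarrow> real \<Rightarrow> bool" where
  "general_position d \<Sigma> u c \<longleftrightarrow>
     (\<forall>\<rho>\<in>\<Sigma>. cone_dim d \<rho> = 1 \<longrightarrow> \<not> \<rho> \<subseteq> boundary_hyperplane d u c)"

definition fan_inter :: "real vec set set \<Rightarrow> real vec set \<Rightarrow> real vec set set" where
  "fan_inter \<Sigma> H = {\<sigma> \<inter> H | \<sigma>. \<sigma> \<in> \<Sigma>}"


section \<open>Integral \<open>p\<close>-groups\<close>

text \<open>An element of \<open>\<And>\<^sup>p\<int>\<^sup>d\<close> is represented by its coordinates with respect to the standard basis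
  \<open>e\<^sub>I = e\<^bsub>i\<^sub>1\<^esub> \<and> \<dots> \<and> e\<^bsub>i\<^sub>p\<^esub>\<close>, indexed by the \<open>p\<close>-subsets \<open>I = {i\<^sub>1 < \<dots> < i\<^sub>p}\<close> of \<open>{0..<d}\<close>.\<close>

definition exterior_power :: "nat \<Rightarrow> nat \<Rightarrow> (nat set \<Rightarrow> int) monoid" where
  "exterior_power d p =
     \<lparr>carrier = {\<omega>. \<forall>I. \<omega> I \<noteq> 0 \<longrightarrow> I \<subseteq> {0..<d} \<and> card I = p},
      monoid.mult = (\<lambda>\<alpha> \<beta> I. \<alpha> I + \<beta> I), monoid.one = (\<lambda>I. 0)\<rparr>"

text \<open>The \<open>e\<^sub>I\<close>-coordinate of \<open>v\<^sub>1 \<and> \<dots> \<and> v\<^sub>p\<close> is the maximal minor, with columns \<open>I\<close>, of the matrix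
  with rows \<open>v\<^sub>1, \<dots>, v\<^sub>p\<close>.\<close>

definition wedge :: "nat \<Rightarrow> int vec list \<Rightarrow> nat set \<Rightarrow> int" where
  "wedge d vs I =
     (if I \<subseteq> {0..<d} \<and> card I = length vs then det (submatrix (mat_of_rows d vs) UNIV I) else 0)"

definition integral_group :: "nat \<Rightarrow> nat \<Rightarrow> real vec set set \<Rightarrow> (nat set \<Rightarrow> int) set" where
  "integral_group d p \<Sigma> =
     generate (exterior_power d p)
       {wedge d vs | vs. length vs = p \<and> set vs \<subseteq> carrier_vec d \<and>
          (\<exists>\<sigma>\<in>\<Sigma>. \<forall>v\<in>set vs. map_vec of_int v \<in> lin d \<sigma>)}"

lemma group_exterior_power: "comm_group (exterior_power d p)"
proof (rule comm_groupI)
  fix x assume x: "x \<in> carrier (exterior_power d p)"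
  show "\<exists>y\<in>carrier (exterior_power d p). y \<otimes>\<^bsub>exterior_power d p\<^esub> x = \<one>\<^bsub>exterior_power d p\<^esub>"
    using x by (intro bexI[of _ "\<lambda>I. - x I"]) (auto simp: exterior_power_def)
next
  fix x y assume "x \<in> carrier (exterior_power d p)" "y \<in> carrier (exterior_power d p)"
  then show "x \<otimes>\<^bsub>exterior_power d p\<^esub> y \<in> carrier (exterior_power d p)"
    by (simp add: exterior_power_def) (metis add_0)
qed (auto simp: exterior_power_def algebra_simps)

end

theory Submission
  imports Defs
begin

text \<open>Take the Fano plane with the lines 123, 145, 167, 246, 257, 347, 356 and the halfspace
  \<open>\<langle>u, \<cdot>\<rangle> \<ge> 0\<close> with \<open>\<langle>u, e\<^sub>i\<rangle> = 4\<close> on the line 167 and \<open>\<langle>u, e\<^sub>i\<rangle> = -3\<close> on its complement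
  \<open>Q = {2, 3, 4, 5}\<close>. The only rays inside the halfspace are those of the points 1, 6, 7 and of the
  line 167, so a cone through none of these meets the halfspace in the origin only. Every other cone
  spans at most \<open>e\<^sub>a, e\<^sub>\<ell>\<close> with \<open>a\<close> on both 167 and \<open>\<ell>\<close>, and the coordinates of its points
  are constant on \<open>\<ell> \<inter> Q\<close> and on \<open>Q - \<ell>\<close>. These sets have even size, so all lattice vectors spanned by the cut fan have an even sum
  of coordinates over \<open>Q\<close>, whereas \<open>e\<^sub>2\<close> does not.\<close>

section \<open>Matroids of Steiner triple systems\<close>

lemma card_le_matroid_rank:
  assumes "finite X" "Y \<subseteq> X" "indep Y"
  shows "card Y \<le> matroid_rank indep X"
  unfolding matroid_rank_def using assms by (intro Max_ge) auto

lemma matroid_rank_le: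
  assumes "finite X" "indep {}" "\<And>Y. Y \<subseteq> X \<Longrightarrow> indep Y \<Longrightarrow> card Y \<le> k"
  shows "matroid_rank indep X \<le> k"
  unfolding matroid_rank_def using assms by (subst Max_le_iff) auto

locale steiner_triple_system =
  fixes E :: "'a set" and L :: "'a set set"
  assumes finite_points: "finite E"
    and line_subset: "l \<in> L \<Longrightarrow> l \<subseteq> E"
    and line_card: "l \<in> L \<Longrightarrow> card l = 3"
    and line_through: "a \<in> E \<Longrightarrow> b \<in> E \<Longrightarrow> a \<noteq> b \<Longrightarrow> \<exists>l\<in>L. a \<in> l \<and> b \<in> l"
    and line_unique: "l \<in> L \<Longrightarrow> l' \<in> L \<Longrightarrow> {a, b} \<subseteq> l \<inter> l' \<Longrightarrow> a \<noteq> b \<Longrightarrow> l = l'"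
begin

text \<open>The matroid of rank at most 3 in which a triple is dependent exactly when it is
  collinear. Lines have three points, so the condition \<open>X \<notin> L\<close> restricts triples
  only.\<close>

definition indep :: "'a set \<Rightarrow> bool" where
  "indep X \<longleftrightarrow> X \<subseteq> E \<and> card X \<le> 3 \<and> X \<notin> L"

lemma indepI: "X \<subseteq> E \<Longrightarrow> card X < 3 \<Longrightarrow> indep X"
  using line_card by (auto simp: indep_def)

lemma finite_subset_points: "X \<subseteq> E \<Longrightarrow> finite X"
  using finite_points finite_subset by blast

text \<open>Augmentation is delicate only from a pair \<open>{a, b}\<close> to a triple
  \<open>X\<close>. If every point of \<open>X - Y\<close> completed the pair to a line, all these
  lines would share \<open>a\<close> and \<open>b\<close>, hence coincide, and \<open>X\<close>
  itself would be that line, contrary to its independence.\<close>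

lemma matroid: "matroid E indep"
proof
  fix X Y assume X: "indep X" and YX: "Y \<subseteq> X"
  show "indep Y"
  proof (cases "Y = X")
    case False
    then have "card Y < card X"
      using X YX finite_subset_points by (intro psubset_card_mono) (auto simp: indep_def)
    then show ?thesis using X YX by (intro indepI) (auto simp: indep_def)
  qed (use X in simp)
next
  fix X Y assume X: "indep X" and Y: "indep Y" and less: "card Y < card X"
  have fin: "finite X" "finite Y" using X Y finite_subset_points by (auto simp: indep_def)
  obtain x where x: "x \<in> X" "x \<notin> Y" using less card_mono[OF fin(2), of X] by force
  have insert_indep: "indep (insert z Y)" if "z \<in> X - Y" "insert z Y \<notin> L" for z
    using that X Y less fin by (auto simp: indep_def)
  show "\<exists>x\<in>X - Y. indep (insert x Y)"
  proof (cases "card Y = 2")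
    case False
    then have "card (insert x Y) < 3" using X less x fin by (auto simp: indep_def)
    then have "insert x Y \<notin> L" using line_card by auto
    then show ?thesis using insert_indep x by blast
  next
    case True
    then have card_X: "card X = 3" using X less by (auto simp: indep_def)
    obtain a b where ab: "Y = {a, b}" "a \<noteq> b" using True by (auto simp: card_2_iff)
    show ?thesis
    proof (rule ccontr)
      assume "\<not> ?thesis"
      then have line: "insert z Y \<in> L" if "z \<in> X - Y" for z using insert_indep that by blast
      have "X \<subseteq> insert x Y"
      proof
        fix z assume "z \<in> X"
        show "z \<in> insert x Y"
        proof (cases "z \<in> Y")
          case False
          then have "insert z Y = insert x Y"
            using line_unique[OF line line, of z x a b] x \<open>z \<in> X\<close> ab by auto
          then show ?thesis by blast
        qed simp
      qed
      then have "X = insert x Y" using fin x True card_X by (intro card_subset_eq) auto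
      then show False using line[of x] x X by (auto simp: indep_def)
    qed
  qed
qed (use finite_points in \<open>auto simp: indep_def dest: line_card\<close>)

lemma loopless: "loopless E indep"
  by (auto simp: loopless_def intro!: indepI)

lemma rank_line_le:
  assumes "l \<in> L" shows "matroid_rank indep l \<le> 2"
proof (rule matroid_rank_le)
  show fin: "finite l" using assms line_subset finite_subset_points by blast
  show "indep {}" by (simp add: indepI)
  fix Y assume Y: "Y \<subseteq> l" "indep Y"
  then have "Y \<subset> l" using assms by (auto simp: indep_def)
  then show "card Y \<le> 2"
    using psubset_card_mono[OF fin, of Y] line_card[OF assms] by simp
qed

section \<open>Flats of the triple system\<close>

lemma flat_point:
  assumes "a \<in> E" shows "flat E indep {a}"
  unfolding flat_def
proof (intro conjI ballI)
  fix x assume x: "x \<in> E - {a}"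
  have "matroid_rank indep {a} \<le> 1"
    by (rule matroid_rank_le) (auto simp: indepI subset_singleton_iff)
  moreover have "card {x, a} \<le> matroid_rank indep {x, a}"
    using assms x by (intro card_le_matroid_rank indepI) auto
  ultimately show "matroid_rank indep {a} < matroid_rank indep {x, a}" using x by simp
qed (use assms in simp)

lemma flat_line:
  assumes l: "l \<in> L" shows "flat E indep l"
  unfolding flat_def
proof (intro conjI ballI)
  fix x assume x: "x \<in> E - l"
  have fin: "finite l" using l line_subset finite_subset_points by blast
  obtain a b c where abc: "l = {a, b, c}" "a \<noteq> b" "a \<noteq> c" "b \<noteq> c"
    using line_card[OF l] by (auto simp: card_3_iff)
  \<comment> \<open>A line through \<open>a\<close> and \<open>b\<close> must be \<open>l\<close>,
    which misses \<open>x\<close>. So two points of \<open>l\<close> together with \<open>x\<close>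
    are independent, and the rank grows to 3.\<close>
  have "{x, a, b} \<notin> L"
    using line_unique[OF l, of "{x, a, b}" a b] abc x by auto
  then have "indep {x, a, b}"
    using line_subset[OF l] abc x by (auto simp: indep_def)
  then have "card {x, a, b} \<le> matroid_rank indep (insert x l)"
    using fin abc by (intro card_le_matroid_rank) auto
  moreover have "card {x, a, b} = 3" using abc x by auto
  ultimately show "matroid_rank indep l < matroid_rank indep (insert x l)"
    using rank_line_le[OF l] by linarith
qed (use line_subset[OF l] in simp)

text \<open>A flat other than \<open>E\<close> has rank at most 2, so all its triples are collinear.
  If it has two points \<open>a\<close> and \<open>b\<close>, it therefore lies in the line through
  them; it fills that line because points of the line cannot raise the rank.\<close>

lemma proper_flat_iff:
  assumes "F \<noteq> {}" "F \<noteq> E"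
  shows "flat E indep F \<longleftrightarrow> (\<exists>a\<in>E. F = {a}) \<or> F \<in> L"
proof
  assume flat: "flat E indep F"
  then have FE: "F \<subseteq> E" by (simp add: flat_def)
  then have fin: "finite F" by (rule finite_subset_points)
  obtain x where x: "x \<in> E" "x \<notin> F" using FE assms by blast
  have increase: "matroid_rank indep F < matroid_rank indep (insert x F)"
    using flat x by (auto simp: flat_def)
  have "matroid_rank indep (insert x F) \<le> 3"
    using fin by (intro matroid_rank_le) (auto simp: indep_def line_card dest: line_card)
  then have rank: "matroid_rank indep F \<le> 2" using increase by linarith
  have triple: "T \<in> L" if "T \<subseteq> F" "card T = 3" for T
  proof (rule ccontr)
    assume "T \<notin> L"
    then have "indep T" using that FE by (auto simp: indep_def)
    then show False using card_le_matroid_rank[OF fin that(1), of indep] rank that by simp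
  qed
  obtain a where a: "a \<in> F" using assms by blast
  show "(\<exists>a\<in>E. F = {a}) \<or> F \<in> L"
  proof (cases "F = {a}")
    case False
    then obtain b where b: "b \<in> F" "b \<noteq> a" using a by blast
    then obtain l where l: "l \<in> L" "a \<in> l" "b \<in> l" using line_through a FE by blast
    have "F \<subseteq> l"
    proof
      fix z assume z: "z \<in> F"
      show "z \<in> l"
      proof (cases "z = a \<or> z = b")
        case False
        then have "{a, b, z} \<in> L" using a b z by (intro triple) auto
        then show ?thesis using line_unique[OF l(1), of "{a, b, z}" a b] l b by auto
      qed (use l in auto)
    qed
    have "l \<subseteq> F"
    proof
      fix z assume z: "z \<in> l"
      show "z \<in> F"
      proof (rule ccontr)
        assume "z \<notin> F"
        \<comment> \<open>By flatness the missing point \<open>z\<close> would raise the rank, but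
          \<open>{a, b}\<close> already gives \<open>F\<close> rank 2, and \<open>insert z F\<close>
          still lies in the line \<open>l\<close> of rank at most 2.\<close>
        then have "matroid_rank indep F < matroid_rank indep (insert z F)"
          using flat z line_subset[OF l(1)] by (auto simp: flat_def)
        moreover have "card {a, b} \<le> matroid_rank indep F"
          using a b FE fin by (intro card_le_matroid_rank indepI) auto
        moreover have "matroid_rank indep (insert z F) \<le> 2"
        proof (rule matroid_rank_le)
          fix Y assume "Y \<subseteq> insert z F" "indep Y"
          then show "card Y \<le> 2"
            using card_le_matroid_rank[of l Y indep] rank_line_le[OF l(1)] z \<open>F \<subseteq> l\<close>
              finite_subset_points[OF line_subset[OF l(1)]] by fastforce
        qed (use fin in \<open>auto simp: indepI\<close>)
        ultimately show False using b by simp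
      qed
    qed
    then show ?thesis using \<open>F \<subseteq> l\<close> l by auto
  qed (use a FE in auto)
qed (auto simp: flat_point flat_line)

text \<open>Nonempty proper flats have one or three elements, and comparable finite sets of equal
  size coincide, so a chain contains at most one flat of each size.\<close>

lemma flat_chain:
  assumes "subset.chain {F. flat E indep F \<and> F \<noteq> {} \<and> F \<noteq> E} C"
  shows "finite C" "card C \<le> 2"
proof -
  have C: "F \<subseteq> E" "card F \<in> {1, 3}" if "F \<in> C" for F
  proof -
    have F: "flat E indep F" "F \<noteq> {}" "F \<noteq> E" using assms that by (auto simp: subset_chain_def)
    then show "F \<subseteq> E" by (simp add: flat_def)
    show "card F \<in> {1, 3}" using F proper_flat_iff[of F] line_card by auto
  qed
  show "finite C"
    using C(1) finite_points by (intro finite_subset[of C "Pow E"]) auto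
  have "inj_on card C"
  proof
    fix F G assume FG: "F \<in> C" "G \<in> C" "card F = card G"
    then have "F \<subseteq> G \<or> G \<subseteq> F" using assms by (auto simp: subset_chain_def)
    then show "F = G"
      using FG C(1) finite_subset_points card_subset_eq by metis
  qed
  then have "card C = card (card ` C)" by (simp add: card_image)
  also have "\<dots> \<le> card {1, 3 :: nat}" using C(2) by (intro card_mono) auto
  finally show "card C \<le> 2" by simp
qed

end

section \<open>Linear spans of cones\<close>

lemma lin_mono: "S \<subseteq> T \<Longrightarrow> lin d S \<subseteq> lin d T"
proof -
  interpret vec_space "TYPE(real)" d .
  show "S \<subseteq> T \<Longrightarrow> lin d S \<subseteq> lin d T" unfolding lin_def by (rule span_is_monotone)
qed

lemma subset_pos:
  assumes "S \<subseteq> carrier_vec d" shows "S \<subseteq> pos d S"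
proof
  interpret vec_space "TYPE(real)" d .
  fix v assume v: "v \<in> S"
  then have "finsum_vec TYPE(real) d (\<lambda>v. 1 \<cdot>\<^sub>v v) {v} = v"
    using assms by (auto simp: finsum_insert)
  then show "v \<in> pos d S"
    unfolding pos_def using v by (intro CollectI exI[of _ "{v}"] exI[of _ "\<lambda>v. 1"]) auto
qed

lemma pos_subset_lin: "pos d S \<subseteq> lin d S"
proof -
  interpret vec_space "TYPE(real)" d .
  show ?thesis unfolding pos_def lin_def span_def lincomb_def by auto
qed

lemma lin_pos:
  assumes "S \<subseteq> carrier_vec d" shows "lin d (pos d S) = lin d S"
proof
  interpret vec_space "TYPE(real)" d .
  show "lin d (pos d S) \<subseteq> lin d S"
    using span_subsetI[OF assms, of "pos d S"] pos_subset_lin unfolding lin_def by blast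
  show "lin d S \<subseteq> lin d (pos d S)" by (intro lin_mono subset_pos assms)
qed

text \<open>Equality of two coordinates is a linear condition, so it passes from generators to their
  span.\<close>

lemma lin_coordinates_eq:
  assumes "v \<in> lin d S" "S \<subseteq> carrier_vec d" "i < d" "j < d" "\<And>x. x \<in> S \<Longrightarrow> x $ i = x $ j"
  shows "v $ i = v $ j"
proof -
  interpret vec_space "TYPE(real)" d .
  obtain a A where A: "v = lincomb a A" "A \<subseteq> S"
    using assms(1) unfolding lin_def span_def by auto
  then have "A \<subseteq> carrier_vec d" using assms(2) by blast
  then show ?thesis
    using A assms by (auto simp: lincomb_index intro!: sum.cong)
qed

text \<open>On the cone, the product with \<open>u\<close> is a combination of negative numbers with
  nonnegative coefficients. It can be nonnegative only if every coefficient vanishes.\<close>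

lemma pos_negative_inter_halfspace:
  assumes S: "S \<subseteq> carrier_vec d" and u: "u \<in> carrier_vec d" and neg: "\<And>v. v \<in> S \<Longrightarrow> u \<bullet> v < 0"
  shows "pos d S \<inter> closed_halfspace d u 0 \<subseteq> {0\<^sub>v d}"
proof
  interpret vec_space "TYPE(real)" d .
  fix x assume x: "x \<in> pos d S \<inter> closed_halfspace d u 0"
  then obtain A a where A: "x = finsum V (\<lambda>v. a v \<cdot>\<^sub>v v) A" "finite A" "A \<subseteq> S"
    and a: "\<And>v. v \<in> A \<Longrightarrow> 0 \<le> a v"
    by (auto simp: pos_def)
  have AC: "(\<lambda>v. a v \<cdot>\<^sub>v v) \<in> A \<rightarrow> carrier_vec d" using A S by auto
  have xC: "x \<in> carrier_vec d" using x by (simp add: closed_halfspace_def)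
  have "u \<bullet> x = x \<bullet> u" using u xC by (rule comm_scalar_prod)
  also have "\<dots> = (\<Sum>v\<in>A. (a v \<cdot>\<^sub>v v) \<bullet> u)"
    unfolding A(1) by (rule finsum_scalar_prod_sum[OF AC u])
  also have "\<dots> = (\<Sum>v\<in>A. a v * (u \<bullet> v))"
    using A S u by (intro sum.cong) (auto simp: comm_scalar_prod[of _ d u])
  finally have inner: "u \<bullet> x = (\<Sum>v\<in>A. a v * (u \<bullet> v))" .
  have nonneg: "0 \<le> a v * - (u \<bullet> v)" if "v \<in> A" for v
    using that a[OF that] neg[of v] A by (intro mult_nonneg_nonneg) force+
  have "(\<Sum>v\<in>A. a v * - (u \<bullet> v)) \<le> 0"
    using x inner by (simp add: closed_halfspace_def sum_negf)
  then have "(\<Sum>v\<in>A. a v * - (u \<bullet> v)) = 0"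
    by (intro antisym sum_nonneg nonneg)
  then have "\<forall>v\<in>A. a v * - (u \<bullet> v) = 0"
    using nonneg A(2) by (subst (asm) sum_nonneg_eq_0_iff) auto
  then have "a v = 0" if "v \<in> A" for v using that neg[of v] A by fastforce
  then have "x = finsum V (\<lambda>v. 0\<^sub>v d) A"
    unfolding A(1) using A S by (intro finsum_cong') auto
  then show "x \<in> {0\<^sub>v d}" by simp
qed

lemma cone_dim_pos_le:
  assumes "finite S" "S \<subseteq> carrier_vec d"
  shows "cone_dim d (pos d S) \<le> card S"
proof -
  interpret vec_space "TYPE(real)" d .
  have sub: "S \<subseteq> span S" using assms in_own_span by simp
  have submod: "submodule class_ring (span S) V" using assms span_is_submodule by simp
  \<comment> \<open>\<open>cone_dim\<close> measures the span as a vector space in its own right.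
    Spanning inside it agrees with spanning in the ambient space, so \<open>S\<close> generates
    it.\<close>
  interpret W: vectorspace class_ring "vs (span S)"
    using assms span_is_subspace subspace_def subspace_is_vs by simp
  have "W.dim \<le> card S"
    using assms sub span_li_not_depend(1)[OF sub submod] fin_dim_span[of S]
    by (intro W.gen_ge_dim) auto
  then show ?thesis
    using assms by (simp add: cone_dim_def lin_pos) (simp add: lin_def)
qed

text \<open>Independence is assumed coordinatewise, so that for concrete vectors it can be checked
  on a few coordinates.\<close>

lemma cone_dim_pos_eq:
  assumes "finite S" "S \<subseteq> carrier_vec d"
    and indpt: "\<And>a. (\<And>i. i < d \<Longrightarrow> (\<Sum>v\<in>S. a v * v $ i) = 0) \<Longrightarrow> \<forall>v\<in>S. a v = 0"
  shows "cone_dim d (pos d S) = card S"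
proof -
  interpret vec_space "TYPE(real)" d .
  have sub: "S \<subseteq> span S" using assms in_own_span by simp
  have submod: "submodule class_ring (span S) V" using assms span_is_submodule by simp
  interpret W: vectorspace class_ring "vs (span S)"
    using assms span_is_subspace subspace_def subspace_is_vs by simp
  have "lin_indpt S"
  proof (rule finite_lin_indpt2)
    fix a assume "lincomb a S = 0\<^sub>v d"
    then have "(\<Sum>v\<in>S. a v * v $ i) = 0" if "i < d" for i
      using lincomb_index[OF that assms(2), of a] that by simp
    then show "\<forall>v\<in>S. a v = 0" using indpt by blast
  qed (use assms in auto)
  then have "W.basis S"
    using sub span_li_not_depend[OF sub submod] by (auto simp: W.basis_def)
  then have "W.dim = card S" using assms by (intro W.dim_basis) auto
  then show ?thesis
    using assms by (simp add: cone_dim_def lin_pos) (simp add: lin_def)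
qed

section \<open>Integral groups\<close>

lemma wedge_in_exterior_power:
  "length vs = p \<Longrightarrow> wedge d vs \<in> carrier (exterior_power d p)"
  by (auto simp: exterior_power_def wedge_def)

lemma subgroup_integral_group: "subgroup (integral_group d p \<Sigma>) (exterior_power d p)"
proof -
  interpret comm_group "exterior_power d p" by (rule group_exterior_power)
  show ?thesis
    unfolding integral_group_def
    by (rule generate_is_subgroup) (auto simp: wedge_in_exterior_power)
qed

text \<open>Cutting a cone can only shrink its span, so each generator for the cut fan is also one
  for the whole fan.\<close>

lemma subgroup_integral_group_fan_inter:
  "subgroup (integral_group d p (fan_inter \<Sigma> H))
     (exterior_power d p\<lparr>carrier := integral_group d p \<Sigma>\<rparr>)"
proof -
  interpret comm_group "exterior_power d p" by (rule group_exterior_power)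
  have "integral_group d p (fan_inter \<Sigma> H) \<subseteq> integral_group d p \<Sigma>"
    unfolding integral_group_def
  proof (rule mono_generate, safe)
    fix vs \<tau> assume vs: "set vs \<subseteq> carrier_vec d" "p = length vs"
      and \<tau>: "\<tau> \<in> fan_inter \<Sigma> H" "\<forall>v\<in>set vs. map_vec of_int v \<in> lin d \<tau>"
    obtain \<sigma> where "\<sigma> \<in> \<Sigma>" "\<tau> = \<sigma> \<inter> H" using \<tau> by (auto simp: fan_inter_def)
    then have "\<exists>\<sigma>\<in>\<Sigma>. \<forall>v\<in>set vs. map_vec of_int v \<in> lin d \<sigma>"
      using \<tau> lin_mono[of \<tau> \<sigma> d] by blast
    then show "\<exists>vs'. wedge d vs = wedge d vs' \<and> length vs' = length vs \<and> set vs' \<subseteq> carrier_vec d \<and>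
        (\<exists>\<sigma>\<in>\<Sigma>. \<forall>v\<in>set vs'. map_vec of_int v \<in> lin d \<sigma>)"
      using vs by blast
  qed
  then show ?thesis by (intro subgroup_incl subgroup_integral_group)
qed

lemma wedge_single:
  assumes "v \<in> carrier_vec d" "j < d" shows "wedge d [v] {j} = v $ j"
proof -
  let ?A = "mat_of_rows d [v]"
  have cols: "{k. k < dim_col ?A \<and> k \<in> {j}} = {j}" using assms by auto
  have "submatrix ?A UNIV {j} \<in> carrier_mat 1 1"
    using cols by (intro carrier_matI) (auto simp: dim_submatrix)
  then have "det (submatrix ?A UNIV {j}) = submatrix ?A UNIV {j} $$ (0, 0)"
    by (rule det_single)
  also have "\<dots> = ?A $$ (0, j)"
  proof -
    \<comment> \<open>An entry keeps, as its position in a submatrix, the number of selected rows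
      and columns before it. Both numbers are zero here, so entry \<open>(0, j)\<close> moves to
      \<open>(0, 0)\<close>.\<close>
    have less: "{k \<in> {j}. k < j} = {}" "{k \<in> UNIV. k < (0 :: nat)} = {}" by auto
    show ?thesis
      using submatrix_index_card[of 0 ?A j UNIV "{j}", unfolded less card.empty] assms by simp
  qed
  also have "\<dots> = v $ j" using assms by (simp add: mat_of_rows_def)
  finally show ?thesis using assms by (simp add: wedge_def)
qed

text \<open>The parity of the coordinate sum over \<open>J\<close> is a homomorphism to the group of
  order two. Its kernel \<open>?K\<close> contains the group as soon as it contains the
  generators.\<close>

lemma integral_group_1_even:
  assumes J: "J \<subseteq> {..<d}"
    and even: "\<And>\<sigma> v. \<sigma> \<in> \<Sigma> \<Longrightarrow> v \<in> carrier_vec d \<Longrightarrow> map_vec of_int v \<in> lin d \<sigma> \<Longrightarrow>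
      even (\<Sum>j\<in>J. v $ j)"
    and \<omega>: "\<omega> \<in> integral_group d 1 \<Sigma>"
  shows "even (\<Sum>j\<in>J. \<omega> {j})"
proof -
  interpret comm_group "exterior_power d 1" by (rule group_exterior_power)
  let ?K = "{\<omega> \<in> carrier (exterior_power d 1). even (\<Sum>j\<in>J. \<omega> {j})}"
  have "integral_group d 1 \<Sigma> \<subseteq> ?K"
    unfolding integral_group_def
  proof (rule generate_subgroup_incl)
    show "subgroup ?K (exterior_power d 1)"
    proof
      fix \<alpha> assume \<alpha>: "\<alpha> \<in> ?K"
      have "inv\<^bsub>exterior_power d 1\<^esub> \<alpha> = (\<lambda>I. - \<alpha> I)"
        using \<alpha> by (intro inv_equality) (auto simp: exterior_power_def)
      then show "inv\<^bsub>exterior_power d 1\<^esub> \<alpha> \<in> ?K"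
        using \<alpha> inv_closed[of \<alpha>] by (simp add: sum_negf)
    next
      fix \<alpha> \<beta> assume "\<alpha> \<in> ?K" "\<beta> \<in> ?K"
      then show "\<alpha> \<otimes>\<^bsub>exterior_power d 1\<^esub> \<beta> \<in> ?K"
        using m_closed[of \<alpha> \<beta>] by (auto simp: exterior_power_def sum.distrib)
    qed (auto simp: exterior_power_def)
    show "{wedge d vs |vs. length vs = 1 \<and> set vs \<subseteq> carrier_vec d \<and>
        (\<exists>\<sigma>\<in>\<Sigma>. \<forall>v\<in>set vs. map_vec of_int v \<in> lin d \<sigma>)} \<subseteq> ?K"
    proof safe
      fix vs :: "int vec list" and \<sigma>
      assume len: "length vs = 1" and "set vs \<subseteq> carrier_vec d" "\<sigma> \<in> \<Sigma>"
        "\<forall>v\<in>set vs. map_vec of_int v \<in> lin d \<sigma>"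
      then obtain v where v: "vs = [v]" "v \<in> carrier_vec d" "map_vec of_int v \<in> lin d \<sigma>"
        by (cases vs) auto
      have "(\<Sum>j\<in>J. wedge d vs {j}) = (\<Sum>j\<in>J. v $ j)"
        using J v by (intro sum.cong) (auto simp: wedge_single)
      then show "even (\<Sum>j\<in>J. wedge d vs {j})" using even[OF \<open>\<sigma> \<in> \<Sigma>\<close> v(2,3)] by simp
      show "wedge d vs \<in> carrier (exterior_power d 1)" using len by (rule wedge_in_exterior_power)
    qed
  qed
  then show ?thesis using \<omega> by blast
qed

section \<open>A lattice frame\<close>

text \<open>Frame vectors are numbered from 1 and coordinates from 0, hence the shift
  \<open>i - 1\<close>. The last vector is minus the sum of the standard basis, which makes the
  total zero.\<close>

definition simplex_frame :: "nat \<Rightarrow> nat \<Rightarrow> int vec" where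
  "simplex_frame m i = (if i < m then unit_vec (m - 1) (i - 1) else vec (m - 1) (\<lambda>_. - 1))"

lemma simplex_frame_closed: "simplex_frame m i \<in> carrier_vec (m - 1)"
  by (auto simp: simplex_frame_def)

lemma simplex_frame_index:
  assumes "i \<in> {1..m}" "j < m - 1"
  shows "simplex_frame m i $ j = of_bool (i = Suc j) - of_bool (i = m)"
  using assms by (auto simp: simplex_frame_def)

lemma finsum_simplex_frame_index:
  assumes "F \<subseteq> {1..m}" "j < m - 1"
  shows "finsum_vec TYPE(int) (m - 1) (simplex_frame m) F $ j = of_bool (Suc j \<in> F) - of_bool (m \<in> F)"
proof -
  have fin: "finite F" using assms(1) finite_subset by blast
  have "finsum_vec TYPE(int) (m - 1) (simplex_frame m) F $ j = (\<Sum>i\<in>F. simplex_frame m i $ j)"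
    using fin assms by (intro index_finsum_vec Pi_I simplex_frame_closed) auto
  also have "\<dots> = (\<Sum>i\<in>F. of_bool (i = Suc j) - of_bool (i = m))"
    using assms by (intro sum.cong refl simplex_frame_index) auto
  also have "\<dots> = of_bool (Suc j \<in> F) - of_bool (m \<in> F)"
    using fin by (simp add: sum_subtractf of_bool_def)
  finally show ?thesis .
qed

lemma flat_vec_simplex_frame:
  assumes "F \<subseteq> {1..m}"
  shows "flat_vec (m - 1) (simplex_frame m) F =
    vec (m - 1) (\<lambda>j. of_bool (Suc j \<in> F) - of_bool (m \<in> F))"
proof -
  have "finsum_vec TYPE(int) (m - 1) (simplex_frame m) F \<in> carrier_vec (m - 1)"
    by (intro finsum_vec_closed Pi_I simplex_frame_closed)
  then show ?thesis
    unfolding flat_vec_def using assms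
    by (intro eq_vecI) (auto simp: finsum_simplex_frame_index[OF assms] simp del: One_nat_def)
qed

lemma lattice_frame_simplex_frame:
  assumes "1 \<le> m" shows "lattice_frame m (simplex_frame m)"
  unfolding lattice_frame_def
proof (intro conjI ballI)
  let ?G = "monoid_vec TYPE(int) (m - 1)"
  let ?S = "simplex_frame m ` {1..m}"
  interpret comm_group ?G by (rule comm_group_vec)
  have S: "?S \<subseteq> carrier ?G" unfolding monoid_vec_simps by (intro image_subsetI simplex_frame_closed)
  let ?K = "generate ?G ?S"
  have K: "subgroup ?K ?G" by (rule generate_is_subgroup[OF S])
  have add: "x + y \<in> ?K" if "x \<in> ?K" "y \<in> ?K" for x y
    using subgroup.m_closed[OF K that] by (simp add: monoid_vec_simps)
  have neg: "- x \<in> ?K" if "x \<in> ?K" for x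
  proof -
    have "x \<in> carrier_vec (m - 1)" using subgroup.subset[OF K] that by (auto simp: monoid_vec_simps)
    then have "inv\<^bsub>?G\<^esub> x = - x"
      by (intro inv_equality) (auto simp: monoid_vec_simps)
    then show ?thesis using subgroup.m_inv_closed[OF K that] by simp
  qed
  have zero: "0\<^sub>v (m - 1) \<in> ?K" using subgroup.one_closed[OF K] by (simp add: monoid_vec_simps)
  \<comment> \<open>Integer multiples are obtained from the group operations: natural multiples by
    repeated addition, the others by negation.\<close>
  have smult_nat: "int n \<cdot>\<^sub>v x \<in> ?K" if x: "x \<in> ?K" for n x
  proof (induction n)
    case 0
    have "x \<in> carrier_vec (m - 1)" using subgroup.subset[OF K] x by (auto simp: monoid_vec_simps)
    then have "int 0 \<cdot>\<^sub>v x = 0\<^sub>v (m - 1)" by auto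
    then show ?case using zero by simp
  next
    case (Suc n)
    have "int (Suc n) \<cdot>\<^sub>v x = x + int n \<cdot>\<^sub>v x"
      by (intro eq_vecI) (auto simp: algebra_simps)
    then show ?case using add[OF x Suc] by simp
  qed
  have smult: "k \<cdot>\<^sub>v x \<in> ?K" if x: "x \<in> ?K" for k :: int and x
  proof (cases k)
    case (nonneg n)
    then show ?thesis using smult_nat[OF x] by simp
  next
    case (neg n)
    then have "k \<cdot>\<^sub>v x = - (int (Suc n) \<cdot>\<^sub>v x)" by (intro eq_vecI) (auto simp del: of_nat_Suc)
    then show ?thesis using \<open>\<And>x. x \<in> ?K \<Longrightarrow> - x \<in> ?K\<close>[OF smult_nat[OF x]] by metis
  qed
  show "?K = carrier_vec (m - 1)"
  proof
    show "?K \<subseteq> carrier_vec (m - 1)" using subgroup.subset[OF K] by (simp add: monoid_vec_simps)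
    show "carrier_vec (m - 1) \<subseteq> ?K"
    proof
      fix x :: "int vec" assume x: "x \<in> carrier_vec (m - 1)"
      \<comment> \<open>The vector is rebuilt one coordinate at a time: extending the truncation by
        coordinate \<open>n\<close> adds a multiple of the frame vector with number
        \<open>Suc n\<close>.\<close>
      have partial: "vec (m - 1) (\<lambda>j. if j < n then x $ j else 0) \<in> ?K" if "n \<le> m - 1" for n
        using that
      proof (induction n)
        case 0
        have "vec (m - 1) (\<lambda>j. if j < 0 then x $ j else 0) = 0\<^sub>v (m - 1)" by auto
        then show ?case using zero by simp
      next
        case (Suc n)
        have "vec (m - 1) (\<lambda>j. if j < Suc n then x $ j else 0) =
            vec (m - 1) (\<lambda>j. if j < n then x $ j else 0) + x $ n \<cdot>\<^sub>v simplex_frame m (Suc n)"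
          using Suc.prems
          by (intro eq_vecI) (auto simp: simplex_frame_def less_Suc_eq)
        moreover have "simplex_frame m (Suc n) \<in> ?K"
          using Suc.prems by (intro generate.incl) auto
        ultimately show ?case using add[OF Suc.IH smult] Suc.prems by simp
      qed
      have "vec (m - 1) (\<lambda>j. if j < m - 1 then x $ j else 0) = x" using x by auto
      then show "x \<in> ?K" using partial[of "m - 1"] by simp
    qed
  qed
  have "finsum_vec TYPE(int) (m - 1) (simplex_frame m) {1..m} \<in> carrier_vec (m - 1)"
    by (intro finsum_vec_closed Pi_I simplex_frame_closed)
  then show "finsum_vec TYPE(int) (m - 1) (simplex_frame m) {1..m} = 0\<^sub>v (m - 1)"
    using assms by (intro eq_vecI) (auto simp: finsum_simplex_frame_index simp del: One_nat_def)
qed (rule simplex_frame_closed)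

section \<open>The Fano plane\<close>

definition fano_lines :: "nat set set" where
  "fano_lines = {{1, 2, 3}, {1, 4, 5}, {1, 6, 7}, {2, 4, 6}, {2, 5, 7}, {3, 4, 7}, {3, 5, 6}}"

lemma atLeastAtMost_1_7: "{1..7 :: nat} = {1, 2, 3, 4, 5, 6, 7}"
  by auto

interpretation fano: steiner_triple_system "{1..7}" fano_lines
proof
  fix a b :: nat assume "a \<in> {1..7}" "b \<in> {1..7}" "a \<noteq> b"
  then show "\<exists>l\<in>fano_lines. a \<in> l \<and> b \<in> l"
    unfolding fano_lines_def atLeastAtMost_1_7 by auto
next
  fix l l' and a b :: nat
  assume "l \<in> fano_lines" "l' \<in> fano_lines" "{a, b} \<subseteq> l \<inter> l'" "a \<noteq> b"
  then show "l = l'" unfolding fano_lines_def by (elim insertE emptyE) auto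
qed (auto simp: fano_lines_def)

abbreviation fano_ray :: "nat set \<Rightarrow> real vec" where
  "fano_ray \<equiv> flat_vec 6 (simplex_frame 7)"

abbreviation fano_fan :: "real vec set set" where
  "fano_fan \<equiv> bergman_fan 7 (simplex_frame 7) fano.indep"

text \<open>An explicit list, so that statements about flats can be settled by going through its
  fourteen members.\<close>

definition fano_flats :: "nat set set" where
  "fano_flats = {{1}, {2}, {3}, {4}, {5}, {6}, {7}} \<union> fano_lines"

lemma fano_flats_eq: "{F. flat {1..7} fano.indep F \<and> F \<noteq> {} \<and> F \<noteq> {1..7}} = fano_flats"
proof -
  have proper: "F \<noteq> {} \<and> F \<noteq> {1..7}" if "F \<in> fano_flats" for F
  proof -
    have "card F \<in> {1, 3}" using that by (auto simp: fano_flats_def dest: fano.line_card)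
    then show ?thesis by auto
  qed
  have "flat {1..7} fano.indep F \<longleftrightarrow> F \<in> fano_flats" if "F \<noteq> {}" "F \<noteq> {1..7}" for F
  proof -
    have "(\<exists>a\<in>{1..7}. F = {a}) \<longleftrightarrow> F \<in> {{1}, {2}, {3}, {4}, {5}, {6}, {7}}"
      unfolding atLeastAtMost_1_7 by simp
    then show ?thesis unfolding fano.proper_flat_iff[OF that] fano_flats_def by blast
  qed
  then show ?thesis using proper by blast
qed

lemma fano_flat_subset: "F \<in> fano_flats \<Longrightarrow> F \<subseteq> {1..7}"
  using fano_flats_eq by (auto simp: flat_def)

lemma fano_ray_eq:
  "F \<in> fano_flats \<Longrightarrow> fano_ray F = vec 6 (\<lambda>j. of_bool (Suc j \<in> F) - of_bool (7 \<in> F))"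
  using flat_vec_simplex_frame[OF fano_flat_subset] by simp

lemma fano_ray_closed: "F \<in> fano_flats \<Longrightarrow> fano_ray F \<in> carrier_vec 6"
  by (simp add: fano_ray_eq)

lemma fano_ray_index:
  "F \<in> fano_flats \<Longrightarrow> j < 6 \<Longrightarrow> fano_ray F $ j = of_bool (Suc j \<in> F) - of_bool (7 \<in> F)"
  by (simp add: fano_ray_eq)

lemma fano_fanE:
  assumes "\<sigma> \<in> fano_fan"
  obtains C where "\<sigma> = pos 6 (fano_ray ` C)" "subset.chain fano_flats C"
  using assms unfolding bergman_fan_def fano_flats_eq by auto

lemma fano_fanI: "subset.chain fano_flats C \<Longrightarrow> pos 6 (fano_ray ` C) \<in> fano_fan"
  unfolding bergman_fan_def fano_flats_eq by auto

lemma fano_rays_closed: "subset.chain fano_flats C \<Longrightarrow> fano_ray ` C \<subseteq> carrier_vec 6"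
  using fano_ray_closed by (auto simp: subset_chain_def)

lemma cone_dim_fano:
  assumes "subset.chain fano_flats C"
  shows "cone_dim 6 (pos 6 (fano_ray ` C)) \<le> card C"
proof -
  have fin: "finite C" using fano.flat_chain(1) assms unfolding fano_flats_eq by blast
  have "cone_dim 6 (pos 6 (fano_ray ` C)) \<le> card (fano_ray ` C)"
    using fin fano_rays_closed[OF assms] by (intro cone_dim_pos_le) auto
  also have "\<dots> \<le> card C" using fin by (rule card_image_le)
  finally show ?thesis .
qed

lemma fan_dim_fano: "fan_dim 6 fano_fan = 2"
  unfolding fan_dim_def
proof (rule Max_eqI)
  have le: "cone_dim 6 \<sigma> \<le> 2" if \<sigma>: "\<sigma> \<in> fano_fan" for \<sigma>
  proof -
    obtain C where C: "\<sigma> = pos 6 (fano_ray ` C)" "subset.chain fano_flats C"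
      using \<sigma> by (rule fano_fanE)
    then have "card C \<le> 2" using fano.flat_chain(2) unfolding fano_flats_eq by blast
    then show ?thesis using cone_dim_fano[OF C(2)] C(1) by simp
  qed
  have "cone_dim 6 ` fano_fan \<subseteq> {..2}" using le by auto
  then show "finite (cone_dim 6 ` fano_fan)" by (rule finite_subset) simp
  show "k \<le> 2" if "k \<in> cone_dim 6 ` fano_fan" for k using that le by auto
  \<comment> \<open>A point on a line gives a two-dimensional cone: on coordinates 0 and 1 its rays
    are \<open>(1, 0)\<close> and \<open>(1, 1)\<close>, which are independent.\<close>
  let ?C = "{{1}, {1, 2, 3 :: nat}}"
  have flats: "{1} \<in> fano_flats" "{1, 2, 3} \<in> fano_flats"
    by (auto simp: fano_flats_def fano_lines_def)
  then have chain: "subset.chain fano_flats ?C" by (auto simp: subset_chain_def)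
  have ne: "fano_ray {1} \<noteq> fano_ray {1, 2, 3}"
  proof
    assume "fano_ray {1} = fano_ray {1, 2, 3}"
    then have "fano_ray {1} $ 1 = fano_ray {1, 2, 3} $ 1" by simp
    then show False using flats by (simp add: fano_ray_index)
  qed
  have "cone_dim 6 (pos 6 (fano_ray ` ?C)) = card (fano_ray ` ?C)"
  proof (rule cone_dim_pos_eq)
    fix a assume a: "\<And>i. i < 6 \<Longrightarrow> (\<Sum>v\<in>fano_ray ` ?C. a v * v $ i) = 0"
    show "\<forall>v\<in>fano_ray ` ?C. a v = 0"
      using a[of 0] a[of 1] ne flats by (simp add: fano_ray_index)
  qed (use fano_rays_closed[OF chain] in auto)
  also have "\<dots> = 2" using ne by simp
  finally show "2 \<in> cone_dim 6 ` fano_fan" using fano_fanI[OF chain] by (metis imageI)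
qed

lemma is_bergman_fan_fano: "is_bergman_fan 6 fano_fan"
  unfolding is_bergman_fan_def
  using fano.matroid fano.loopless lattice_frame_simplex_frame[of 7]
  by (intro exI[of _ 7] exI[of _ fano.indep] exI[of _ "simplex_frame 7"]) auto

section \<open>The halfspace\<close>

text \<open>Coordinates 0 and 5 belong to the points 1 and 6. The entries sum to -4, so the vector
  of the point 7, with all entries -1, has product 4 as well.\<close>

definition fano_normal :: "real vec" where
  "fano_normal = vec 6 (\<lambda>j. if j = 0 \<or> j = 5 then 4 else - 3)"

lemma fano_normal_closed: "fano_normal \<in> carrier_vec 6"
  by (simp add: fano_normal_def)

text \<open>Products add over the points of a flat. A line other than 167 meets it in exactly one
  point, which gives 4 - 3 - 3 = -2.\<close>

lemma fano_normal_inner: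
  assumes "F \<in> fano_flats"
  shows "fano_normal \<bullet> fano_ray F =
    (if F \<in> {{1}, {6}, {7}} then 4 else if F = {1, 6, 7} then 12 else if card F = 1 then - 3 else - 2)"
proof -
  have "{0..<6} = {0, 1, 2, 3, 4, 5 :: nat}" by auto
  then have "fano_normal \<bullet> fano_ray F =
      4 * of_bool (1 \<in> F) - 3 * of_bool (2 \<in> F) - 3 * of_bool (3 \<in> F) - 3 * of_bool (4 \<in> F) -
      3 * of_bool (5 \<in> F) + 4 * of_bool (6 \<in> F) + 4 * of_bool (7 \<in> F)"
    by (simp add: fano_ray_eq[OF assms] scalar_prod_def fano_normal_def flip: numeral_2_eq_2)
  then show ?thesis
    using assms unfolding fano_flats_def fano_lines_def by (elim UnE insertE emptyE) (simp_all, (auto dest!: equalityD1)?)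
qed

lemma general_position_fano: "general_position 6 fano_fan fano_normal 0"
  unfolding general_position_def
proof (intro ballI impI notI)
  fix \<rho> assume \<rho>: "\<rho> \<in> fano_fan" "cone_dim 6 \<rho> = 1" "\<rho> \<subseteq> boundary_hyperplane 6 fano_normal 0"
  obtain C where C: "\<rho> = pos 6 (fano_ray ` C)" "subset.chain fano_flats C"
    using \<rho>(1) by (rule fano_fanE)
  \<comment> \<open>The empty chain yields a cone of dimension 0. Any other cone contains the vector
    of some flat, and no such vector has product 0 with the normal.\<close>
  then have "C \<noteq> {}" using \<rho>(2) cone_dim_fano[OF C(2)] by auto
  then obtain F where F: "F \<in> C" "F \<in> fano_flats" using C(2) by (auto simp: subset_chain_def)
  then have "fano_ray F \<in> \<rho>" using C subset_pos[OF fano_rays_closed[OF C(2)]] by auto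
  then have "fano_normal \<bullet> fano_ray F = 0" using \<rho>(3) by (auto simp: boundary_hyperplane_def)
  then show False using fano_normal_inner[OF F(2)] by (simp split: if_splits)
qed

section \<open>Parity on the cut fan\<close>

text \<open>Coordinate \<open>j\<close> belongs to the point \<open>j + 1\<close>, so the points of \<open>Q\<close> have coordinates 1 to 4.\<close>

lemma even_sum_pairing:
  fixes v :: "int vec"
  assumes "i < 6" "j < 6" "k < 6" "l < 6" "{i, j, k, l} = {1, 2, 3, 4}"
    and S: "S \<subseteq> carrier_vec 6" "\<And>x. x \<in> S \<Longrightarrow> x $ i = x $ j \<and> x $ k = x $ l"
    and v: "v \<in> carrier_vec 6" "map_vec of_int v \<in> lin 6 S"
  shows "even (\<Sum>j\<in>{1, 2, 3, 4}. v $ j)"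
proof -
  have "v $ i = v $ j" "v $ k = v $ l"
    using lin_coordinates_eq[OF v(2) S(1), of i j] lin_coordinates_eq[OF v(2) S(1), of k l]
      assms v by auto
  \<comment> \<open>The four indices exhaust a set of four elements, so none repeats and the sum
    splits into two equal pairs.\<close>
  moreover have "distinct [i, j, k, l]"
    using arg_cong[OF assms(5), of card] by (intro card_distinct) simp
  ultimately have "(\<Sum>j\<in>{i, j, k, l}. v $ j) = 2 * (v $ i + v $ k)"
    by simp
  then show ?thesis unfolding assms(5) by simp
qed

text \<open>The lines through 1 other than 167 split \<open>Q\<close> into 23 and 45, those through
  6 into 24 and 35, those through 7 into 25 and 34. Each case uses the matching pairing of
  coordinates.\<close>

lemma even_halfspace:
  assumes \<tau>: "\<tau> \<in> fan_inter fano_fan (closed_halfspace 6 fano_normal 0)"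
    and v: "v \<in> carrier_vec 6" "map_vec of_int v \<in> lin 6 \<tau>"
  shows "even (\<Sum>j\<in>{1, 2, 3, 4}. v $ j)"
proof -
  obtain \<sigma> where \<sigma>: "\<sigma> \<in> fano_fan" "\<tau> = \<sigma> \<inter> closed_halfspace 6 fano_normal 0"
    using \<tau> by (auto simp: fan_inter_def)
  obtain C where C: "\<sigma> = pos 6 (fano_ray ` C)" "subset.chain fano_flats C"
    using \<sigma>(1) by (rule fano_fanE)
  have flats: "C \<subseteq> fano_flats" using C(2) by (simp add: subset_chain_def)
  show ?thesis
  proof (cases "\<exists>F\<in>C. F \<in> {{1}, {6}, {7}, {1, 6, 7}}")
    case False
    have "fano_normal \<bullet> x < 0" if x: "x \<in> fano_ray ` C" for x
    proof -
      obtain F where F: "F \<in> C" "x = fano_ray F" using x by blast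
      then have "F \<notin> {{1}, {6}, {7}, {1, 6, 7}}" "F \<in> fano_flats" using False flats by blast+
      then show ?thesis unfolding F(2) by (subst fano_normal_inner) simp_all
    qed
    then have "\<tau> \<subseteq> {0\<^sub>v 6}"
      unfolding \<sigma>(2) C(1)
      by (intro pos_negative_inter_halfspace fano_rays_closed C fano_normal_closed)
    then have "map_vec of_int v \<in> lin 6 {0\<^sub>v 6}" using v(2) lin_mono by blast
    then show ?thesis by (intro even_sum_pairing[of 1 2 3 4 "{0\<^sub>v 6}"] v) auto
  next
    case True
    then obtain F where F: "F \<in> C" "F \<in> {{1}, {6}, {7}, {1, 6, 7}}" by blast
    \<comment> \<open>The halfspace can now be forgotten: parity already holds on the span of the
      whole cone.\<close>
    have "\<tau> \<subseteq> pos 6 (fano_ray ` C)" using \<sigma>(2) C(1) by blast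
    then have lin: "map_vec of_int v \<in> lin 6 (fano_ray ` C)"
      using v(2) lin_mono lin_pos[OF fano_rays_closed[OF C(2)]] by blast
    have comparable: "G \<in> fano_flats" "F \<subseteq> G \<or> G \<subseteq> F" if "G \<in> C" for G
      using that C(2) F(1) by (auto simp: subset_chain_def)
    have pairing: "even (\<Sum>j\<in>{1, 2, 3, 4}. v $ j)"
      if ijkl: "i < 6" "j < 6" "k < 6" "l < 6" "{i, j, k, l} = {1, 2, 3, 4}"
        and mem: "\<And>G. G \<in> C \<Longrightarrow> (Suc i \<in> G \<longleftrightarrow> Suc j \<in> G) \<and> (Suc k \<in> G \<longleftrightarrow> Suc l \<in> G)"
      for i j k l
    proof (rule even_sum_pairing[OF ijkl fano_rays_closed[OF C(2)] _ v(1) lin])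
      fix x assume "x \<in> fano_ray ` C"
      then obtain G where "G \<in> C" "x = fano_ray G" by blast
      then show "x $ i = x $ j \<and> x $ k = x $ l"
        using mem[of G] ijkl comparable(1)[of G] by (simp add: fano_ray_index)
    qed
    \<comment> \<open>Flats comparable with 167 all miss \<open>Q\<close>, so any pairing serves
      there; that case is joined to the point 1.\<close>
    consider "F = {1} \<or> F = {1, 6, 7}" | "F = {6}" | "F = {7}" using F(2) by blast
    then show ?thesis
    proof cases
      case 1
      have "(Suc 1 \<in> G \<longleftrightarrow> Suc 2 \<in> G) \<and> (Suc 3 \<in> G \<longleftrightarrow> Suc 4 \<in> G)" if "G \<in> C" for G
        using comparable[OF that] 1 unfolding fano_flats_def fano_lines_def
        by (elim UnE insertE emptyE) auto
      then show ?thesis by (intro pairing[of 1 2 3 4]) auto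
    next
      case 2
      have "(Suc 1 \<in> G \<longleftrightarrow> Suc 3 \<in> G) \<and> (Suc 2 \<in> G \<longleftrightarrow> Suc 4 \<in> G)" if "G \<in> C" for G
        using comparable[OF that] 2 unfolding fano_flats_def fano_lines_def
        by (elim UnE insertE emptyE) auto
      then show ?thesis by (intro pairing[of 1 3 2 4]) auto
    next
      case 3
      have "(Suc 1 \<in> G \<longleftrightarrow> Suc 4 \<in> G) \<and> (Suc 2 \<in> G \<longleftrightarrow> Suc 3 \<in> G)" if "G \<in> C" for G
        using comparable[OF that] 3 unfolding fano_flats_def fano_lines_def
        by (elim UnE insertE emptyE) auto
      then show ?thesis by (intro pairing[of 1 4 2 3]) auto
    qed
  qed
qed

section \<open>An odd vector in the uncut fan, and the strict inclusion\<close>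

lemma unit_wedge_in_integral_group: "wedge 6 [unit_vec 6 1] \<in> integral_group 6 1 fano_fan"
proof -
  have flat: "{2} \<in> fano_flats" by (simp add: fano_flats_def)
  then have chain: "subset.chain fano_flats {{2}}" by (simp add: subset_chain_def)
  \<comment> \<open>Coordinate 1 belongs to the point 2, whose ray lies in the fan but outside the
    halfspace.\<close>
  have "map_vec of_int (unit_vec 6 1) = fano_ray {2}"
    using flat by (intro eq_vecI) (auto simp: fano_ray_eq)
  then have "map_vec of_int (unit_vec 6 1) \<in> pos 6 (fano_ray ` {{2}})"
    using subset_pos[OF fano_rays_closed[OF chain]] by auto
  then have "map_vec of_int (unit_vec 6 1) \<in> lin 6 (pos 6 (fano_ray ` {{2}}))"
    using pos_subset_lin lin_pos[OF fano_rays_closed[OF chain]] by blast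
  then show ?thesis
    unfolding integral_group_def
    by (intro generate.incl CollectI exI[of _ "[unit_vec 6 1]"] conjI bexI[OF _ fano_fanI[OF chain]])
      auto
qed

theorem proposition11p5:
  shows "\<exists>(d :: nat) (B :: real vec set set) (u :: real vec) (c :: real).
    is_bergman_fan d B \<and> fan_dim d B = 2 \<and>
    u \<in> carrier_vec d \<and> u \<noteq> 0\<^sub>v d \<and>
    0\<^sub>v d \<in> boundary_hyperplane d u c \<and>
    general_position d B u c \<and>
    subgroup (integral_group d 1 (fan_inter B (closed_halfspace d u c)))
      ((exterior_power d 1)\<lparr>carrier := integral_group d 1 B\<rparr>) \<and>
    integral_group d 1 (fan_inter B (closed_halfspace d u c)) \<noteq> integral_group d 1 B"
proof (intro exI conjI)
  show "is_bergman_fan 6 fano_fan" by (rule is_bergman_fan_fano)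
  show "fan_dim 6 fano_fan = 2" by (rule fan_dim_fano)
  show "fano_normal \<in> carrier_vec 6" by (rule fano_normal_closed)
  show "fano_normal \<noteq> 0\<^sub>v 6"
  proof
    assume "fano_normal = 0\<^sub>v 6"
    then have "fano_normal $ 0 = 0\<^sub>v 6 $ 0" by (rule arg_cong)
    then show False by (simp add: fano_normal_def)
  qed
  show "0\<^sub>v 6 \<in> boundary_hyperplane 6 fano_normal 0"
    using fano_normal_closed by (simp add: boundary_hyperplane_def)
  show "general_position 6 fano_fan fano_normal 0" by (rule general_position_fano)
  let ?\<Sigma> = "fan_inter fano_fan (closed_halfspace 6 fano_normal 0)"
  show "subgroup (integral_group 6 1 ?\<Sigma>) (exterior_power 6 1\<lparr>carrier := integral_group 6 1 fano_fan\<rparr>)"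
    by (rule subgroup_integral_group_fan_inter)
  show "integral_group 6 1 ?\<Sigma> \<noteq> integral_group 6 1 fano_fan"
  proof
    assume "integral_group 6 1 ?\<Sigma> = integral_group 6 1 fano_fan"
    then have "wedge 6 [unit_vec 6 1] \<in> integral_group 6 1 ?\<Sigma>"
      using unit_wedge_in_integral_group by simp
    \<comment> \<open>The only nonzero term is the one for coordinate 1, so this sum equals
      1.\<close>
    then have "even (\<Sum>j\<in>{1, 2, 3, 4}. wedge 6 [unit_vec 6 1] {j})"
      by (intro integral_group_1_even[OF _ even_halfspace]) auto
    then show False by (simp add: wedge_single)
  qed
qed

end
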